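(* Let $(T,\mu,\eta)$ be a monad on a dagger category $\mathcal{C}$. Then $T$ is a Frobenius monad if and only if the Kleisli category $\mathcal{C}_T$ has a dagger such that (1) the canonical functors $\mathcal{C}\to\mathcal{C}_T$ and $\mathcal{C}_T\to\mathcal{C}$ are dagger functors, and (2) for every object $A$, the morphism $\mu_A^\dagger\colon T(A)\to T^2(A)$ of $\mathcal{C}$, regarded as a morphism $T(A)\to T(A)$ of $\mathcal{C}_T$, is self-adjoint.
   Context: A dagger category has an identity-on-objects contravariant functor $f\mapsto f^\dagger$ with $f^{\dagger\dagger}=f$; a dagger functor $F$ satisfies $F(f^\dagger)=F(f)^\dagger$; an endomorphism $f$ is self-adjoint if $f^\dagger=f$. A Frobenius monad on $\mathcal{C}$ is a monad $(T,\mu,\eta)$ with $T(f^\dagger)=T(f)^\dagger$ for all $f$ and $T(\mu_A)\circ\mu^\dagger_{T(A)}=\mu_{T(A)}\circ T(\mu_A^\dagger)$ for all $A$. The Kleisli category $\mathcal{C}_T$ has the objects of $\mathcal{C}$, morphisms $A\to B$ the morphisms $A\to T(B)$ of $\mathcal{C}$, identities $\eta$, and composition $g\circ_T f=\mu\circ T(g)\circ f$. The canonical functor $\mathcal{C}_T\to\mathcal{C}$ maps $A\mapsto T(A)$, $f\mapsto\mu\circ T(f)$; the canonical functor $\mathcal{C}\to\mathcal{C}_T$ maps $A\mapsto A$, $f\mapsto\eta\circ f$. *)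

theory Defs
  imports Main
begin

text \<open>
  Categories are given by families of hom-sets that need not be disjoint, so composition (and
  later the dagger and the action of a functor on arrows) takes the objects involved as arguments.
  This lets a Kleisli arrow \<open>A \<rightarrow> B\<close> literally be an arrow \<open>A \<rightarrow> T B\<close>, even though \<open>T\<close> need not be
  injective on objects. \<open>Comp C A B D g f\<close> is the composite of \<open>f : A \<rightarrow> B\<close> and \<open>g : B \<rightarrow> D\<close>.
\<close>

record ('o, 'm) cat =
  Obj :: "'o set"
  Hom :: "'o \<Rightarrow> 'o \<Rightarrow> 'm set"
  Idt :: "'o \<Rightarrow> 'm"
  Comp :: "'o \<Rightarrow> 'o \<Rightarrow> 'o \<Rightarrow> 'm \<Rightarrow> 'm \<Rightarrow> 'm"

locale category =
  fixes C :: "('o, 'm) cat"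
  assumes Idt_in_Hom: "A \<in> Obj C \<Longrightarrow> Idt C A \<in> Hom C A A"
    and Comp_in_Hom:
      "\<lbrakk>A \<in> Obj C; B \<in> Obj C; D \<in> Obj C; f \<in> Hom C A B; g \<in> Hom C B D\<rbrakk>
        \<Longrightarrow> Comp C A B D g f \<in> Hom C A D"
    and Comp_Idt_left:
      "\<lbrakk>A \<in> Obj C; B \<in> Obj C; f \<in> Hom C A B\<rbrakk> \<Longrightarrow> Comp C A B B (Idt C B) f = f"
    and Comp_Idt_right:
      "\<lbrakk>A \<in> Obj C; B \<in> Obj C; f \<in> Hom C A B\<rbrakk> \<Longrightarrow> Comp C A A B f (Idt C A) = f"
    and Comp_assoc:
      "\<lbrakk>A \<in> Obj C; B \<in> Obj C; D \<in> Obj C; E \<in> Obj C;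
        f \<in> Hom C A B; g \<in> Hom C B D; h \<in> Hom C D E\<rbrakk>
        \<Longrightarrow> Comp C A D E h (Comp C A B D g f) = Comp C A B E (Comp C B D E h g) f"

record ('o, 'm, 'p, 'n) cfunctor =
  onObj :: "'o \<Rightarrow> 'p"
  onHom :: "'o \<Rightarrow> 'o \<Rightarrow> 'm \<Rightarrow> 'n"

locale is_functor = dom: category C + cod: category D
  for C :: "('o, 'm) cat" and D :: "('p, 'n) cat" +
  fixes F :: "('o, 'm, 'p, 'n) cfunctor"
  assumes onObj_in_Obj: "A \<in> Obj C \<Longrightarrow> onObj F A \<in> Obj D"
    and onHom_in_Hom:
      "\<lbrakk>A \<in> Obj C; B \<in> Obj C; f \<in> Hom C A B\<rbrakk>
        \<Longrightarrow> onHom F A B f \<in> Hom D (onObj F A) (onObj F B)"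
    and onHom_Idt: "A \<in> Obj C \<Longrightarrow> onHom F A A (Idt C A) = Idt D (onObj F A)"
    and onHom_Comp:
      "\<lbrakk>A \<in> Obj C; B \<in> Obj C; E \<in> Obj C; f \<in> Hom C A B; g \<in> Hom C B E\<rbrakk>
        \<Longrightarrow> onHom F A E (Comp C A B E g f) =
            Comp D (onObj F A) (onObj F B) (onObj F E) (onHom F B E g) (onHom F A B f)"

definition id_functor :: "('o, 'm, 'o, 'm) cfunctor" where
  "id_functor = \<lparr>onObj = (\<lambda>A. A), onHom = (\<lambda>A B f. f)\<rparr>"

definition comp_functor ::
  "('p, 'n, 'q, 'k) cfunctor \<Rightarrow> ('o, 'm, 'p, 'n) cfunctor \<Rightarrow> ('o, 'm, 'q, 'k) cfunctor" where
  "comp_functor G F =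
    \<lparr>onObj = (\<lambda>A. onObj G (onObj F A)),
     onHom = (\<lambda>A B f. onHom G (onObj F A) (onObj F B) (onHom F A B f))\<rparr>"

locale natural_transformation =
  src: is_functor C D F + tgt: is_functor C D G
  for C :: "('o, 'm) cat" and D :: "('p, 'n) cat"
    and F G :: "('o, 'm, 'p, 'n) cfunctor" +
  fixes \<tau> :: "'o \<Rightarrow> 'n"
  assumes component_in_Hom: "A \<in> Obj C \<Longrightarrow> \<tau> A \<in> Hom D (onObj F A) (onObj G A)"
    and naturality:
      "\<lbrakk>A \<in> Obj C; B \<in> Obj C; f \<in> Hom C A B\<rbrakk>
        \<Longrightarrow> Comp D (onObj F A) (onObj F B) (onObj G B) (\<tau> B) (onHom F A B f) =
            Comp D (onObj F A) (onObj G A) (onObj G B) (onHom G A B f) (\<tau> A)"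

locale monad =
  is_functor C C T +
  unit: natural_transformation C C id_functor T \<eta> +
  mult: natural_transformation C C "comp_functor T T" T \<mu>
  for C :: "('o, 'm) cat" and T :: "('o, 'm, 'o, 'm) cfunctor"
    and \<mu> :: "'o \<Rightarrow> 'm" and \<eta> :: "'o \<Rightarrow> 'm" +
  assumes mult_assoc:
      "A \<in> Obj C \<Longrightarrow>
        Comp C (onObj T (onObj T (onObj T A))) (onObj T (onObj T A)) (onObj T A)
          (\<mu> A) (onHom T (onObj T (onObj T A)) (onObj T A) (\<mu> A)) =
        Comp C (onObj T (onObj T (onObj T A))) (onObj T (onObj T A)) (onObj T A)
          (\<mu> A) (\<mu> (onObj T A))"
    and mult_unit_left:
      "A \<in> Obj C \<Longrightarrow>
        Comp C (onObj T A) (onObj T (onObj T A)) (onObj T A) (\<mu> A) (\<eta> (onObj T A)) =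
        Idt C (onObj T A)"
    and mult_unit_right:
      "A \<in> Obj C \<Longrightarrow>
        Comp C (onObj T A) (onObj T (onObj T A)) (onObj T A)
          (\<mu> A) (onHom T A (onObj T A) (\<eta> A)) =
        Idt C (onObj T A)"

text \<open>\<open>dag A B\<close> is the action of the dagger on \<open>Hom C A B\<close>.\<close>

locale dagger_category = category C
  for C :: "('o, 'm) cat" +
  fixes dag :: "'o \<Rightarrow> 'o \<Rightarrow> 'm \<Rightarrow> 'm"
  assumes dag_in_Hom:
      "\<lbrakk>A \<in> Obj C; B \<in> Obj C; f \<in> Hom C A B\<rbrakk> \<Longrightarrow> dag A B f \<in> Hom C B A"
    and dag_Idt: "A \<in> Obj C \<Longrightarrow> dag A A (Idt C A) = Idt C A"
    and dag_Comp:
      "\<lbrakk>A \<in> Obj C; B \<in> Obj C; D \<in> Obj C; f \<in> Hom C A B; g \<in> Hom C B D\<rbrakk>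
        \<Longrightarrow> dag A D (Comp C A B D g f) = Comp C D B A (dag A B f) (dag B D g)"
    and dag_dag:
      "\<lbrakk>A \<in> Obj C; B \<in> Obj C; f \<in> Hom C A B\<rbrakk> \<Longrightarrow> dag B A (dag A B f) = f"

locale dagger_functor =
  dagdom: dagger_category C dagC + dagcod: dagger_category D dagD + is_functor C D F
  for C :: "('o, 'm) cat" and dagC and D :: "('p, 'n) cat" and dagD
    and F :: "('o, 'm, 'p, 'n) cfunctor" +
  assumes onHom_dag:
    "\<lbrakk>A \<in> Obj C; B \<in> Obj C; f \<in> Hom C A B\<rbrakk>
      \<Longrightarrow> onHom F B A (dagC A B f) = dagD (onObj F A) (onObj F B) (onHom F A B f)"

definition self_adjoint ::
  "('o, 'm) cat \<Rightarrow> ('o \<Rightarrow> 'o \<Rightarrow> 'm \<Rightarrow> 'm) \<Rightarrow> 'o \<Rightarrow> 'm \<Rightarrow> bool" where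
  "self_adjoint C dag A f \<longleftrightarrow> f \<in> Hom C A A \<and> dag A A f = f"

text \<open>The component of \<open>\<mu>\<^sup>\<dagger>\<close> at \<open>A\<close>, an arrow \<open>T A \<rightarrow> T (T A)\<close>.\<close>

definition mult_dag ::
  "('o \<Rightarrow> 'o \<Rightarrow> 'm \<Rightarrow> 'm) \<Rightarrow> ('o, 'm, 'o, 'm) cfunctor \<Rightarrow> ('o \<Rightarrow> 'm) \<Rightarrow> 'o \<Rightarrow> 'm" where
  "mult_dag dag T \<mu> A = dag (onObj T (onObj T A)) (onObj T A) (\<mu> A)"

locale frobenius_monad =
  monad C T \<mu> \<eta> + dagger_functor C dag C dag T
  for C :: "('o, 'm) cat" and dag and T :: "('o, 'm, 'o, 'm) cfunctor"
    and \<mu> :: "'o \<Rightarrow> 'm" and \<eta> :: "'o \<Rightarrow> 'm" +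
  assumes frobenius_law:
    "A \<in> Obj C \<Longrightarrow>
      Comp C (onObj T (onObj T A)) (onObj T (onObj T (onObj T A))) (onObj T (onObj T A))
        (onHom T (onObj T (onObj T A)) (onObj T A) (\<mu> A)) (mult_dag dag T \<mu> (onObj T A)) =
      Comp C (onObj T (onObj T A)) (onObj T (onObj T (onObj T A))) (onObj T (onObj T A))
        (\<mu> (onObj T A)) (onHom T (onObj T A) (onObj T (onObj T A)) (mult_dag dag T \<mu> A))"

definition kleisli ::
  "('o, 'm) cat \<Rightarrow> ('o, 'm, 'o, 'm) cfunctor \<Rightarrow> ('o \<Rightarrow> 'm) \<Rightarrow> ('o \<Rightarrow> 'm) \<Rightarrow> ('o, 'm) cat" where
  "kleisli C T \<mu> \<eta> =
    \<lparr>Obj = Obj C,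
     Hom = (\<lambda>A B. Hom C A (onObj T B)),
     Idt = \<eta>,
     Comp = (\<lambda>A B D g f.
       Comp C A (onObj T (onObj T D)) (onObj T D) (\<mu> D)
         (Comp C A (onObj T B) (onObj T (onObj T D)) (onHom T B (onObj T D) g) f))\<rparr>"

definition to_kleisli ::
  "('o, 'm) cat \<Rightarrow> ('o, 'm, 'o, 'm) cfunctor \<Rightarrow> ('o \<Rightarrow> 'm) \<Rightarrow> ('o, 'm, 'o, 'm) cfunctor" where
  "to_kleisli C T \<eta> =
    \<lparr>onObj = (\<lambda>A. A), onHom = (\<lambda>A B f. Comp C A B (onObj T B) (\<eta> B) f)\<rparr>"

definition from_kleisli ::
  "('o, 'm) cat \<Rightarrow> ('o, 'm, 'o, 'm) cfunctor \<Rightarrow> ('o \<Rightarrow> 'm) \<Rightarrow> ('o, 'm, 'o, 'm) cfunctor" where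
  "from_kleisli C T \<mu> =
    \<lparr>onObj = onObj T,
     onHom = (\<lambda>A B f. Comp C (onObj T A) (onObj T (onObj T B)) (onObj T B)
       (\<mu> B) (onHom T A (onObj T B) f))\<rparr>"

end

theory Submission
  imports Defs
begin

text \<open>
  Write \<open>K\<close> for the canonical functor from the Kleisli category to \<open>C\<close> and \<open>J\<close> for the one from
  \<open>C\<close> to the Kleisli category. Then \<open>K \<circ> J = T\<close>, and \<open>K\<close> is faithful because \<open>f = K f \<circ> \<eta>\<close>. So a
  Kleisli dagger for which \<open>K\<close> is a dagger functor exists iff the image of \<open>K\<close> is closed under
  the dagger of \<open>C\<close>, and all its laws can be checked after applying \<open>K\<close>. For a Frobenius monad,
  the Frobenius law and naturality of \<open>\<mu>\<^sup>\<dagger>\<close> give \<open>K (T f\<^sup>\<dagger> \<circ> \<mu>\<^sup>\<dagger> \<circ> \<eta>) = T f\<^sup>\<dagger> \<circ> \<mu>\<^sup>\<dagger> = (K f)\<^sup>\<dagger>\<close>.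
  Finally \<open>K (\<mu>\<^sup>\<dagger>) = \<mu> \<circ> T \<mu>\<^sup>\<dagger>\<close>, whose self-adjointness is precisely the Frobenius law.
\<close>

section \<open>The Kleisli category and its canonical functors\<close>

context monad
begin

abbreviation T\<^sub>0 :: "'o \<Rightarrow> 'o" where "T\<^sub>0 \<equiv> onObj T"

abbreviation K :: "'o \<Rightarrow> 'o \<Rightarrow> 'm \<Rightarrow> 'm" where "K \<equiv> onHom (from_kleisli C T \<mu>)"

abbreviation J :: "'o \<Rightarrow> 'o \<Rightarrow> 'm \<Rightarrow> 'm" where "J \<equiv> onHom (to_kleisli C T \<eta>)"

abbreviation Kl :: "('o, 'm) cat" where "Kl \<equiv> kleisli C T \<mu> \<eta>"

lemma unit_in_Hom: "A \<in> Obj C \<Longrightarrow> \<eta> A \<in> Hom C A (T\<^sub>0 A)"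
  using unit.component_in_Hom by (simp add: id_functor_def)

lemma mult_in_Hom: "A \<in> Obj C \<Longrightarrow> \<mu> A \<in> Hom C (T\<^sub>0 (T\<^sub>0 A)) (T\<^sub>0 A)"
  using mult.component_in_Hom by (simp add: comp_functor_def)

text \<open>Every categorical law here is conditional on hom-set membership; these typing rules let
  simp discharge those side conditions.\<close>

lemmas hom_intros = onObj_in_Obj onHom_in_Hom unit_in_Hom mult_in_Hom
  dom.Idt_in_Hom dom.Comp_in_Hom

lemma unit_naturality:
  "\<lbrakk>A \<in> Obj C; B \<in> Obj C; f \<in> Hom C A B\<rbrakk>
    \<Longrightarrow> Comp C A B (T\<^sub>0 B) (\<eta> B) f = Comp C A (T\<^sub>0 A) (T\<^sub>0 B) (onHom T A B f) (\<eta> A)"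
  using unit.naturality by (simp add: id_functor_def)

lemma mult_naturality:
  "\<lbrakk>A \<in> Obj C; B \<in> Obj C; f \<in> Hom C A B\<rbrakk>
    \<Longrightarrow> Comp C (T\<^sub>0 (T\<^sub>0 A)) (T\<^sub>0 (T\<^sub>0 B)) (T\<^sub>0 B) (\<mu> B) (onHom T (T\<^sub>0 A) (T\<^sub>0 B) (onHom T A B f)) =
      Comp C (T\<^sub>0 (T\<^sub>0 A)) (T\<^sub>0 A) (T\<^sub>0 B) (onHom T A B f) (\<mu> A)"
  using mult.naturality by (simp add: comp_functor_def)

lemma kleisli_simps [simp]:
  "Obj Kl = Obj C"
  "Hom Kl A B = Hom C A (T\<^sub>0 B)"
  "Idt Kl = \<eta>"
  by (simp_all add: kleisli_def)

lemma canonical_onObj [simp]: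
  "onObj (from_kleisli C T \<mu>) = T\<^sub>0"
  "onObj (to_kleisli C T \<eta>) A = A"
  by (simp_all add: from_kleisli_def to_kleisli_def)

lemma from_kleisli_onHom:
  "K A B f = Comp C (T\<^sub>0 A) (T\<^sub>0 (T\<^sub>0 B)) (T\<^sub>0 B) (\<mu> B) (onHom T A (T\<^sub>0 B) f)"
  by (simp add: from_kleisli_def)

lemma to_kleisli_onHom: "J A B f = Comp C A B (T\<^sub>0 B) (\<eta> B) f"
  by (simp add: to_kleisli_def)

lemma from_kleisli_in_Hom:
  "\<lbrakk>A \<in> Obj C; B \<in> Obj C; f \<in> Hom C A (T\<^sub>0 B)\<rbrakk> \<Longrightarrow> K A B f \<in> Hom C (T\<^sub>0 A) (T\<^sub>0 B)"
  by (simp add: from_kleisli_onHom hom_intros)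

lemma to_kleisli_in_Hom:
  "\<lbrakk>A \<in> Obj C; B \<in> Obj C; f \<in> Hom C A B\<rbrakk> \<Longrightarrow> J A B f \<in> Hom C A (T\<^sub>0 B)"
  by (simp add: to_kleisli_onHom hom_intros)

text \<open>Composing with \<open>g\<close> in the Kleisli category is postcomposing with
  \<open>K g\<close> in \<open>C\<close>, so Kleisli laws become statements about
  \<open>K\<close>.\<close>

lemma kleisli_Comp:
  "\<lbrakk>A \<in> Obj C; B \<in> Obj C; D \<in> Obj C; f \<in> Hom C A (T\<^sub>0 B); g \<in> Hom C B (T\<^sub>0 D)\<rbrakk>
    \<Longrightarrow> Comp Kl A B D g f = Comp C A (T\<^sub>0 B) (T\<^sub>0 D) (K B D g) f"
  by (simp add: kleisli_def from_kleisli_onHom dom.Comp_assoc hom_intros)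

lemma kleisli_Comp_in_Hom:
  "\<lbrakk>A \<in> Obj C; B \<in> Obj C; D \<in> Obj C; f \<in> Hom C A (T\<^sub>0 B); g \<in> Hom C B (T\<^sub>0 D)\<rbrakk>
    \<Longrightarrow> Comp Kl A B D g f \<in> Hom C A (T\<^sub>0 D)"
  by (simp add: kleisli_Comp from_kleisli_in_Hom hom_intros)

text \<open>Naturality of \<open>\<eta>\<close> turns \<open>T f \<circ> \<eta>\<close> into
  \<open>\<eta> \<circ> f\<close>, and the left unit law then cancels
  \<open>\<mu> \<circ> \<eta>\<close>.\<close>

lemma from_kleisli_unit:
  assumes A: "A \<in> Obj C" and B: "B \<in> Obj C" and f: "f \<in> Hom C A (T\<^sub>0 B)"
  shows "Comp C A (T\<^sub>0 A) (T\<^sub>0 B) (K A B f) (\<eta> A) = f"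
proof -
  have "Comp C A (T\<^sub>0 A) (T\<^sub>0 B) (K A B f) (\<eta> A) =
      Comp C A (T\<^sub>0 (T\<^sub>0 B)) (T\<^sub>0 B) (\<mu> B)
        (Comp C A (T\<^sub>0 A) (T\<^sub>0 (T\<^sub>0 B)) (onHom T A (T\<^sub>0 B) f) (\<eta> A))"
    using assms by (simp add: from_kleisli_onHom dom.Comp_assoc hom_intros)
  also have "\<dots> = Comp C A (T\<^sub>0 (T\<^sub>0 B)) (T\<^sub>0 B) (\<mu> B)
        (Comp C A (T\<^sub>0 B) (T\<^sub>0 (T\<^sub>0 B)) (\<eta> (T\<^sub>0 B)) f)"
    using assms by (simp add: unit_naturality[symmetric] hom_intros)
  also have "\<dots> = f"
    using assms by (simp add: dom.Comp_assoc mult_unit_left dom.Comp_Idt_left hom_intros)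
  finally show ?thesis .
qed

lemma from_kleisli_faithful:
  "\<lbrakk>A \<in> Obj C; B \<in> Obj C; f \<in> Hom C A (T\<^sub>0 B); g \<in> Hom C A (T\<^sub>0 B); K A B f = K A B g\<rbrakk>
    \<Longrightarrow> f = g"
  using from_kleisli_unit by metis

lemma from_kleisli_Idt: "A \<in> Obj C \<Longrightarrow> K A A (\<eta> A) = Idt C (T\<^sub>0 A)"
  by (simp add: from_kleisli_onHom mult_unit_right)

text \<open>This is the extension law of a Kleisli triple. Applying \<open>T\<close> to
  \<open>K g \<circ> f\<close> yields a factor \<open>T \<mu>\<close>; associativity trades it for
  \<open>\<mu>\<close> at \<open>T D\<close>, which naturality moves past
  \<open>T (T g)\<close>.\<close>

lemma from_kleisli_extend:
  assumes A: "A \<in> Obj C" and B: "B \<in> Obj C" and D: "D \<in> Obj C"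
    and f: "f \<in> Hom C A (T\<^sub>0 B)" and g: "g \<in> Hom C B (T\<^sub>0 D)"
  shows "K A D (Comp C A (T\<^sub>0 B) (T\<^sub>0 D) (K B D g) f) =
    Comp C (T\<^sub>0 A) (T\<^sub>0 B) (T\<^sub>0 D) (K B D g) (K A B f)"
proof -
  let ?Tg = "onHom T B (T\<^sub>0 D) g" and ?Tf = "onHom T A (T\<^sub>0 B) f"
  \<comment> \<open>The bracketing isolates \<open>\<mu> \<circ> T \<mu>\<close>, ready for
    \<open>mult_assoc\<close>.\<close>
  have "K A D (Comp C A (T\<^sub>0 B) (T\<^sub>0 D) (K B D g) f) =
     Comp C (T\<^sub>0 A) (T\<^sub>0 (T\<^sub>0 B)) (T\<^sub>0 D)
       (Comp C (T\<^sub>0 (T\<^sub>0 B)) (T\<^sub>0 (T\<^sub>0 (T\<^sub>0 D))) (T\<^sub>0 D)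
          (Comp C (T\<^sub>0 (T\<^sub>0 (T\<^sub>0 D))) (T\<^sub>0 (T\<^sub>0 D)) (T\<^sub>0 D)
             (\<mu> D) (onHom T (T\<^sub>0 (T\<^sub>0 D)) (T\<^sub>0 D) (\<mu> D)))
          (onHom T (T\<^sub>0 B) (T\<^sub>0 (T\<^sub>0 D)) ?Tg)) ?Tf"
    using assms by (simp add: from_kleisli_onHom onHom_Comp dom.Comp_assoc hom_intros)
  also have "\<dots> = Comp C (T\<^sub>0 A) (T\<^sub>0 (T\<^sub>0 B)) (T\<^sub>0 D)
       (Comp C (T\<^sub>0 (T\<^sub>0 B)) (T\<^sub>0 (T\<^sub>0 D)) (T\<^sub>0 D) (\<mu> D)
         (Comp C (T\<^sub>0 (T\<^sub>0 B)) (T\<^sub>0 (T\<^sub>0 (T\<^sub>0 D))) (T\<^sub>0 (T\<^sub>0 D)) (\<mu> (T\<^sub>0 D))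
           (onHom T (T\<^sub>0 B) (T\<^sub>0 (T\<^sub>0 D)) ?Tg))) ?Tf"
    using assms by (simp add: mult_assoc dom.Comp_assoc hom_intros)
  also have "\<dots> = Comp C (T\<^sub>0 A) (T\<^sub>0 B) (T\<^sub>0 D) (K B D g) (K A B f)"
    using assms by (simp add: mult_naturality from_kleisli_onHom dom.Comp_assoc hom_intros)
  finally show ?thesis .
qed

lemma from_kleisli_Comp:
  "\<lbrakk>A \<in> Obj C; B \<in> Obj C; D \<in> Obj C; f \<in> Hom C A (T\<^sub>0 B); g \<in> Hom C B (T\<^sub>0 D)\<rbrakk>
    \<Longrightarrow> K A D (Comp Kl A B D g f) = Comp C (T\<^sub>0 A) (T\<^sub>0 B) (T\<^sub>0 D) (K B D g) (K A B f)"
  by (simp add: kleisli_Comp from_kleisli_extend)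

lemma from_kleisli_to_kleisli:
  "\<lbrakk>A \<in> Obj C; B \<in> Obj C; f \<in> Hom C A B\<rbrakk> \<Longrightarrow> K A B (J A B f) = onHom T A B f"
  by (simp add: from_kleisli_onHom to_kleisli_onHom onHom_Comp dom.Comp_assoc
      mult_unit_right dom.Comp_Idt_left hom_intros)

text \<open>Associativity is \<open>from_kleisli_extend\<close> followed by associativity in
  \<open>C\<close>; the unit laws are \<open>from_kleisli_Idt\<close> and
  \<open>from_kleisli_unit\<close>.\<close>

lemma kleisli_category: "category Kl"
proof
  show "Comp Kl A D E h (Comp Kl A B D g f) = Comp Kl A B E (Comp Kl B D E h g) f"
    if "A \<in> Obj Kl" "B \<in> Obj Kl" "D \<in> Obj Kl" "E \<in> Obj Kl"
      "f \<in> Hom Kl A B" "g \<in> Hom Kl B D" "h \<in> Hom Kl D E" for A B D E f g h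
    using that
    by (simp add: kleisli_Comp from_kleisli_extend from_kleisli_in_Hom dom.Comp_assoc hom_intros)
qed (simp_all add: kleisli_Comp from_kleisli_Idt from_kleisli_in_Hom from_kleisli_unit
    dom.Comp_Idt_left hom_intros)

lemma from_kleisli_functor: "is_functor Kl C (from_kleisli C T \<mu>)"
proof -
  interpret Kl: category Kl by (rule kleisli_category)
  show ?thesis
    by unfold_locales
      (simp_all add: from_kleisli_Idt from_kleisli_in_Hom from_kleisli_Comp onObj_in_Obj)
qed

lemma to_kleisli_functor: "is_functor C Kl (to_kleisli C T \<eta>)"
proof -
  interpret Kl: category Kl by (rule kleisli_category)
  show ?thesis
  proof
    show "J A E (Comp C A B E g f) =
        Comp Kl (onObj (to_kleisli C T \<eta>) A) (onObj (to_kleisli C T \<eta>) B)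
          (onObj (to_kleisli C T \<eta>) E) (J B E g) (J A B f)"
      if "A \<in> Obj C" "B \<in> Obj C" "E \<in> Obj C" "f \<in> Hom C A B" "g \<in> Hom C B E" for A B E f g
      using that
      \<comment> \<open>The Kleisli composite first becomes \<open>T g \<circ> J f\<close>;
        naturality of \<open>\<eta>\<close> then brings both sides to
        \<open>T g \<circ> T f \<circ> \<eta>\<close>.\<close>
      by (simp add: kleisli_Comp to_kleisli_in_Hom from_kleisli_to_kleisli)
        (simp add: to_kleisli_onHom unit_naturality onHom_Comp dom.Comp_assoc[symmetric] hom_intros)
  qed (simp_all add: to_kleisli_in_Hom to_kleisli_onHom dom.Comp_Idt_right hom_intros)
qed

end

section \<open>The Frobenius law as self-adjointness\<close>

locale dagger_monad = dagger_category C dag + monad C T \<mu> \<eta>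
  for C :: "('o, 'm) cat" and dag :: "'o \<Rightarrow> 'o \<Rightarrow> 'm \<Rightarrow> 'm"
    and T :: "('o, 'm, 'o, 'm) cfunctor" and \<mu> \<eta> :: "'o \<Rightarrow> 'm"
begin

lemma mult_dag_in_Hom: "A \<in> Obj C \<Longrightarrow> mult_dag dag T \<mu> A \<in> Hom C (T\<^sub>0 A) (T\<^sub>0 (T\<^sub>0 A))"
  by (simp add: mult_dag_def dag_in_Hom hom_intros)

lemma dag_mult_dag:
  "A \<in> Obj C \<Longrightarrow> dag (T\<^sub>0 A) (T\<^sub>0 (T\<^sub>0 A)) (mult_dag dag T \<mu> A) = \<mu> A"
  by (simp add: mult_dag_def dag_dag hom_intros)

text \<open>When \<open>T\<close> preserves daggers, the two sides of the Frobenius law are each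
  other's daggers, and one of them is \<open>K\<close> of \<open>\<mu>\<^sup>\<dagger>\<close>. Both
  directions of the theorem go through this form.\<close>

lemma frobenius_monad_iff:
  "frobenius_monad C dag T \<mu> \<eta> \<longleftrightarrow>
    dagger_functor C dag C dag T \<and>
    (\<forall>A \<in> Obj C. self_adjoint C dag (T\<^sub>0 (T\<^sub>0 A)) (K (T\<^sub>0 A) (T\<^sub>0 A) (mult_dag dag T \<mu> A)))"
proof (cases "dagger_functor C dag C dag T")
  case True
  then interpret dagger_functor C dag C dag T .
  have "dag (T\<^sub>0 (T\<^sub>0 A)) (T\<^sub>0 (T\<^sub>0 A)) (K (T\<^sub>0 A) (T\<^sub>0 A) (mult_dag dag T \<mu> A)) =
      Comp C (T\<^sub>0 (T\<^sub>0 A)) (T\<^sub>0 (T\<^sub>0 (T\<^sub>0 A))) (T\<^sub>0 (T\<^sub>0 A))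
        (onHom T (T\<^sub>0 (T\<^sub>0 A)) (T\<^sub>0 A) (\<mu> A)) (mult_dag dag T \<mu> (T\<^sub>0 A))"
    if "A \<in> Obj C" for A
    using that
    \<comment> \<open>\<open>mult_dag\<close> stays folded at first so that
      \<open>dag_mult_dag\<close> can cancel the double dagger; unfolding it afterwards matches the
      remaining dagger of \<open>\<mu>\<close> at \<open>T A\<close>.\<close>
    by (simp add: from_kleisli_onHom dag_Comp mult_dag_in_Hom hom_intros onHom_dag[symmetric]
        dag_mult_dag) (simp add: mult_dag_def)
  then show ?thesis
    using True monad_axioms
    by (auto simp: frobenius_monad_def frobenius_monad_axioms_def self_adjoint_def
        from_kleisli_onHom mult_dag_in_Hom hom_intros)
qed (simp add: frobenius_monad_def)

end

section \<open>The Kleisli dagger of a Frobenius monad\<close>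

context frobenius_monad
begin

sublocale dagger_monad C dag T \<mu> \<eta> ..

text \<open>This formula is forced: if \<open>K g = (K f)\<^sup>\<dagger>\<close>, then
  \<open>g = K g \<circ> \<eta>\<close> by \<open>from_kleisli_unit\<close>, and
  \<open>(K f)\<^sup>\<dagger>\<close> is
  \<open>T f\<^sup>\<dagger> \<circ> \<mu>\<^sup>\<dagger>\<close>.\<close>

definition kleisli_dag :: "'o \<Rightarrow> 'o \<Rightarrow> 'm \<Rightarrow> 'm" where
  "kleisli_dag A B f =
    Comp C B (T\<^sub>0 (T\<^sub>0 B)) (T\<^sub>0 A) (onHom T (T\<^sub>0 B) A (dag A (T\<^sub>0 B) f))
      (Comp C B (T\<^sub>0 B) (T\<^sub>0 (T\<^sub>0 B)) (mult_dag dag T \<mu> B) (\<eta> B))"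

lemma kleisli_dag_in_Hom:
  "\<lbrakk>A \<in> Obj C; B \<in> Obj C; f \<in> Hom C A (T\<^sub>0 B)\<rbrakk> \<Longrightarrow> kleisli_dag A B f \<in> Hom C B (T\<^sub>0 A)"
  by (simp add: kleisli_dag_def mult_dag_in_Hom dagdom.dag_in_Hom hom_intros)

text \<open>Take the dagger of the naturality square of \<open>\<mu>\<close> at
  \<open>f\<^sup>\<dagger>\<close>, using that \<open>T\<close> commutes with daggers.\<close>

lemma mult_dag_naturality:
  assumes A: "A \<in> Obj C" and B: "B \<in> Obj C" and f: "f \<in> Hom C A B"
  shows "Comp C (T\<^sub>0 A) (T\<^sub>0 B) (T\<^sub>0 (T\<^sub>0 B)) (mult_dag dag T \<mu> B) (onHom T A B f) =
    Comp C (T\<^sub>0 A) (T\<^sub>0 (T\<^sub>0 A)) (T\<^sub>0 (T\<^sub>0 B)) (onHom T (T\<^sub>0 A) (T\<^sub>0 B) (onHom T A B f))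
      (mult_dag dag T \<mu> A)"
  using arg_cong[OF mult_naturality[OF B A dagdom.dag_in_Hom[OF assms]],
      of "dag (T\<^sub>0 (T\<^sub>0 B)) (T\<^sub>0 A)"] assms
  by (simp add: dagdom.dag_Comp dagdom.dag_in_Hom hom_intros onHom_dag[symmetric]
      dagdom.dag_dag mult_dag_def)

lemma from_kleisli_kleisli_dag:
  assumes A: "A \<in> Obj C" and B: "B \<in> Obj C" and f: "f \<in> Hom C A (T\<^sub>0 B)"
  shows "K B A (kleisli_dag A B f) = dag (T\<^sub>0 A) (T\<^sub>0 B) (K A B f)"
proof -
  let ?f = "dag A (T\<^sub>0 B) f" and ?m = "mult_dag dag T \<mu>"
  let ?Tf = "onHom T (T\<^sub>0 B) A ?f" and ?T\<eta> = "onHom T B (T\<^sub>0 B) (\<eta> B)"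
  note in_Hom = hom_intros dagdom.dag_in_Hom mult_dag_in_Hom
  have "K B A (kleisli_dag A B f) =
      Comp C (T\<^sub>0 B) (T\<^sub>0 (T\<^sub>0 B)) (T\<^sub>0 A)
        (Comp C (T\<^sub>0 (T\<^sub>0 B)) (T\<^sub>0 (T\<^sub>0 (T\<^sub>0 B))) (T\<^sub>0 A)
          (Comp C (T\<^sub>0 (T\<^sub>0 (T\<^sub>0 B))) (T\<^sub>0 (T\<^sub>0 A)) (T\<^sub>0 A)
            (\<mu> A) (onHom T (T\<^sub>0 (T\<^sub>0 B)) (T\<^sub>0 A) ?Tf))
          (onHom T (T\<^sub>0 B) (T\<^sub>0 (T\<^sub>0 B)) (?m B))) ?T\<eta>"
    using assms
    by (simp add: from_kleisli_onHom kleisli_dag_def onHom_Comp dom.Comp_assoc in_Hom)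
  \<comment> \<open>Naturality of \<open>\<mu>\<close> pulls \<open>T f\<^sup>\<dagger>\<close> to
    the front, leaving one side of the Frobenius law at \<open>B\<close> next to
    \<open>T \<eta>\<close>.\<close>
  also have "\<dots> = Comp C (T\<^sub>0 B) (T\<^sub>0 (T\<^sub>0 B)) (T\<^sub>0 A)
        (Comp C (T\<^sub>0 (T\<^sub>0 B)) (T\<^sub>0 (T\<^sub>0 B)) (T\<^sub>0 A) ?Tf
          (Comp C (T\<^sub>0 (T\<^sub>0 B)) (T\<^sub>0 (T\<^sub>0 (T\<^sub>0 B))) (T\<^sub>0 (T\<^sub>0 B))
            (\<mu> (T\<^sub>0 B)) (onHom T (T\<^sub>0 B) (T\<^sub>0 (T\<^sub>0 B)) (?m B)))) ?T\<eta>"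
    using assms by (simp add: mult_naturality dom.Comp_assoc in_Hom)
  also have "\<dots> = Comp C (T\<^sub>0 B) (T\<^sub>0 (T\<^sub>0 B)) (T\<^sub>0 A)
        (Comp C (T\<^sub>0 (T\<^sub>0 B)) (T\<^sub>0 (T\<^sub>0 B)) (T\<^sub>0 A) ?Tf
          (Comp C (T\<^sub>0 (T\<^sub>0 B)) (T\<^sub>0 (T\<^sub>0 (T\<^sub>0 B))) (T\<^sub>0 (T\<^sub>0 B))
            (onHom T (T\<^sub>0 (T\<^sub>0 B)) (T\<^sub>0 B) (\<mu> B)) (?m (T\<^sub>0 B)))) ?T\<eta>"
    using assms by (simp only: frobenius_law)
  \<comment> \<open>Regrouping puts \<open>\<mu>\<^sup>\<dagger>\<close> at \<open>T B\<close>
    directly after \<open>T \<eta>\<close>, so that its naturality at \<open>\<eta>\<close> applies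
    next.\<close>
  also have "\<dots> = Comp C (T\<^sub>0 B) (T\<^sub>0 (T\<^sub>0 (T\<^sub>0 B))) (T\<^sub>0 A)
        (Comp C (T\<^sub>0 (T\<^sub>0 (T\<^sub>0 B))) (T\<^sub>0 (T\<^sub>0 B)) (T\<^sub>0 A) ?Tf
          (onHom T (T\<^sub>0 (T\<^sub>0 B)) (T\<^sub>0 B) (\<mu> B)))
        (Comp C (T\<^sub>0 B) (T\<^sub>0 (T\<^sub>0 B)) (T\<^sub>0 (T\<^sub>0 (T\<^sub>0 B))) (?m (T\<^sub>0 B)) ?T\<eta>)"
    using assms by (simp add: dom.Comp_assoc in_Hom)
  also have "\<dots> = Comp C (T\<^sub>0 B) (T\<^sub>0 (T\<^sub>0 B)) (T\<^sub>0 A)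
        (Comp C (T\<^sub>0 (T\<^sub>0 B)) (T\<^sub>0 (T\<^sub>0 B)) (T\<^sub>0 A) ?Tf
          (Comp C (T\<^sub>0 (T\<^sub>0 B)) (T\<^sub>0 (T\<^sub>0 (T\<^sub>0 B))) (T\<^sub>0 (T\<^sub>0 B))
            (onHom T (T\<^sub>0 (T\<^sub>0 B)) (T\<^sub>0 B) (\<mu> B)) (onHom T (T\<^sub>0 B) (T\<^sub>0 (T\<^sub>0 B)) ?T\<eta>))) (?m B)"
    using assms by (simp add: mult_dag_naturality dom.Comp_assoc in_Hom)
  \<comment> \<open>\<open>T\<close> applied to the right unit law makes
    \<open>T \<mu> \<circ> T (T \<eta>)\<close> an identity.\<close>
  also have "\<dots> = Comp C (T\<^sub>0 B) (T\<^sub>0 (T\<^sub>0 B)) (T\<^sub>0 A) ?Tf (?m B)"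
    using assms
    by (simp add: onHom_Comp[symmetric] mult_unit_right onHom_Idt dom.Comp_Idt_right in_Hom)
  also have "\<dots> = dag (T\<^sub>0 A) (T\<^sub>0 B) (K A B f)"
    using assms
    by (simp add: from_kleisli_onHom dagdom.dag_Comp onHom_dag in_Hom mult_dag_def)
  finally show ?thesis .
qed

text \<open>Faithfulness of \<open>K\<close> reduces each law of the Kleisli dagger to the
  corresponding law in \<open>C\<close>.\<close>

lemma kleisli_dag_eqI:
  assumes "A \<in> Obj C" "B \<in> Obj C" "f \<in> Hom C A (T\<^sub>0 B)" "g \<in> Hom C B (T\<^sub>0 A)"
    and "K B A g = dag (T\<^sub>0 A) (T\<^sub>0 B) (K A B f)"
  shows "kleisli_dag A B f = g"
proof (rule from_kleisli_faithful[of B A])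
  show "K B A (kleisli_dag A B f) = K B A g"
    using assms by (simp add: from_kleisli_kleisli_dag)
qed (use assms in \<open>simp_all add: kleisli_dag_in_Hom\<close>)

lemma kleisli_dagger_category: "dagger_category Kl kleisli_dag"
proof -
  interpret Kl: category Kl by (rule kleisli_category)
  show ?thesis
  proof
    show "kleisli_dag A A (Idt Kl A) = Idt Kl A" if "A \<in> Obj Kl" for A
      by (rule kleisli_dag_eqI)
        (use that in \<open>simp_all add: from_kleisli_Idt dagdom.dag_Idt hom_intros\<close>)
    show "kleisli_dag A D (Comp Kl A B D g f) =
        Comp Kl D B A (kleisli_dag A B f) (kleisli_dag B D g)"
      if "A \<in> Obj Kl" "B \<in> Obj Kl" "D \<in> Obj Kl" "f \<in> Hom Kl A B" "g \<in> Hom Kl B D"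
      for A B D f g
      by (rule kleisli_dag_eqI)
        (use that in \<open>simp_all add: from_kleisli_Comp from_kleisli_kleisli_dag dagdom.dag_Comp
          kleisli_Comp_in_Hom kleisli_dag_in_Hom from_kleisli_in_Hom hom_intros\<close>)
    show "kleisli_dag B A (kleisli_dag A B f) = f"
      if "A \<in> Obj Kl" "B \<in> Obj Kl" "f \<in> Hom Kl A B" for A B f
      by (rule kleisli_dag_eqI)
        (use that in \<open>simp_all add: from_kleisli_kleisli_dag dagdom.dag_dag
          kleisli_dag_in_Hom from_kleisli_in_Hom hom_intros\<close>)
  qed (simp add: kleisli_dag_in_Hom)
qed

lemma from_kleisli_dagger_functor:
  "dagger_functor Kl kleisli_dag C dag (from_kleisli C T \<mu>)"
  by (intro dagger_functor.intro dagger_functor_axioms.intro kleisli_dagger_category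
      dagdom.dagger_category_axioms from_kleisli_functor)
    (simp add: from_kleisli_kleisli_dag)

text \<open>After applying \<open>K\<close>, the claim reads
  \<open>T f\<^sup>\<dagger> = (T f)\<^sup>\<dagger>\<close>, because
  \<open>K \<circ> J = T\<close>.\<close>

lemma to_kleisli_dagger_functor:
  "dagger_functor C dag Kl kleisli_dag (to_kleisli C T \<eta>)"
proof (intro dagger_functor.intro dagger_functor_axioms.intro kleisli_dagger_category
    dagdom.dagger_category_axioms to_kleisli_functor)
  show "J B A (dag A B f) =
      kleisli_dag (onObj (to_kleisli C T \<eta>) A) (onObj (to_kleisli C T \<eta>) B) (J A B f)"
    if "A \<in> Obj C" "B \<in> Obj C" "f \<in> Hom C A B" for A B f
  proof -
    have "kleisli_dag A B (J A B f) = J B A (dag A B f)"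
      by (rule kleisli_dag_eqI)
        (use that in \<open>simp_all add: from_kleisli_to_kleisli onHom_dag to_kleisli_in_Hom
          dagdom.dag_in_Hom\<close>)
    then show ?thesis by simp
  qed
qed

text \<open>The Frobenius law makes \<open>K\<close> of \<open>\<mu>\<^sup>\<dagger>\<close>
  self-adjoint in \<open>C\<close>, and the faithful \<open>K\<close> reflects this.\<close>

lemma mult_dag_self_adjoint:
  assumes "A \<in> Obj C"
  shows "self_adjoint Kl kleisli_dag (T\<^sub>0 A) (mult_dag dag T \<mu> A)"
proof -
  have "self_adjoint C dag (T\<^sub>0 (T\<^sub>0 A)) (K (T\<^sub>0 A) (T\<^sub>0 A) (mult_dag dag T \<mu> A))"
    using assms frobenius_monad_axioms frobenius_monad_iff by blast
  then show ?thesis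
    using assms
    by (auto simp: self_adjoint_def mult_dag_in_Hom hom_intros intro!: kleisli_dag_eqI)
qed

end

section \<open>From a Kleisli dagger back to the Frobenius law\<close>

lemma (in dagger_monad) frobenius_monad_if_kleisli_dagger:
  assumes to: "dagger_functor C dag Kl dagT (to_kleisli C T \<eta>)"
    and from_kl: "dagger_functor Kl dagT C dag (from_kleisli C T \<mu>)"
    and self: "\<And>A. A \<in> Obj C \<Longrightarrow> self_adjoint Kl dagT (T\<^sub>0 A) (mult_dag dag T \<mu> A)"
  shows "frobenius_monad C dag T \<mu> \<eta>"
  unfolding frobenius_monad_iff
proof
  have J: "J B A (dag A B f) = dagT A B (J A B f)"
    if "A \<in> Obj C" "B \<in> Obj C" "f \<in> Hom C A B" for A B f
    using dagger_functor.onHom_dag[OF to that] by simp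
  have K: "K B A (dagT A B f) = dag (T\<^sub>0 A) (T\<^sub>0 B) (K A B f)"
    if "A \<in> Obj C" "B \<in> Obj C" "f \<in> Hom C A (T\<^sub>0 B)" for A B f
    using dagger_functor.onHom_dag[OF from_kl] that by simp
  show "dagger_functor C dag C dag T"
  proof
    fix A B f assume f: "A \<in> Obj C" "B \<in> Obj C" "f \<in> Hom C A B"
    \<comment> \<open>With \<open>T\<close> factored as \<open>K \<circ> J\<close>, the dagger
      passes through \<open>J\<close> first and then through \<open>K\<close>.\<close>
    then have "onHom T B A (dag A B f) = K B A (dagT A B (J A B f))"
      by (simp add: J[symmetric] from_kleisli_to_kleisli dag_in_Hom)
    also have "\<dots> = dag (T\<^sub>0 A) (T\<^sub>0 B) (onHom T A B f)"
      using f by (simp add: K to_kleisli_in_Hom from_kleisli_to_kleisli)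
    finally show "onHom T B A (dag A B f) = dag (T\<^sub>0 A) (T\<^sub>0 B) (onHom T A B f)" .
  qed
  show "\<forall>A \<in> Obj C. self_adjoint C dag (T\<^sub>0 (T\<^sub>0 A)) (K (T\<^sub>0 A) (T\<^sub>0 A) (mult_dag dag T \<mu> A))"
  proof
    fix A assume A: "A \<in> Obj C"
    \<comment> \<open>Dagger functors preserve self-adjoint arrows; here \<open>K\<close> carries
      the one given by \<open>self\<close> into \<open>C\<close>.\<close>
    then show "self_adjoint C dag (T\<^sub>0 (T\<^sub>0 A)) (K (T\<^sub>0 A) (T\<^sub>0 A) (mult_dag dag T \<mu> A))"
      using self[OF A] K[of "T\<^sub>0 A" "T\<^sub>0 A" "mult_dag dag T \<mu> A"]
      by (simp add: self_adjoint_def from_kleisli_in_Hom mult_dag_in_Hom onObj_in_Obj)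
  qed
qed

theorem theorem5p3:
  fixes C :: "('o, 'm) cat"
    and dag :: "'o \<Rightarrow> 'o \<Rightarrow> 'm \<Rightarrow> 'm"
    and T :: "('o, 'm, 'o, 'm) cfunctor"
    and \<mu> \<eta> :: "'o \<Rightarrow> 'm"
  assumes "dagger_category C dag"
    and "monad C T \<mu> \<eta>"
  shows "frobenius_monad C dag T \<mu> \<eta> \<longleftrightarrow>
    (\<exists>dagT :: 'o \<Rightarrow> 'o \<Rightarrow> 'm \<Rightarrow> 'm.
      dagger_category (kleisli C T \<mu> \<eta>) dagT
      \<and> dagger_functor C dag (kleisli C T \<mu> \<eta>) dagT (to_kleisli C T \<eta>)
      \<and> dagger_functor (kleisli C T \<mu> \<eta>) dagT C dag (from_kleisli C T \<mu>)
      \<and> (\<forall>A \<in> Obj C. self_adjoint (kleisli C T \<mu> \<eta>) dagT (onObj T A) (mult_dag dag T \<mu> A)))"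
    (is "_ \<longleftrightarrow> ?kleisli_dagger")
proof
  assume "frobenius_monad C dag T \<mu> \<eta>"
  then interpret frobenius_monad C dag T \<mu> \<eta> .
  show ?kleisli_dagger
    using kleisli_dagger_category to_kleisli_dagger_functor from_kleisli_dagger_functor
      mult_dag_self_adjoint by blast
next
  interpret dagger_monad C dag T \<mu> \<eta>
    using assms by (rule dagger_monad.intro)
  assume ?kleisli_dagger
  then show "frobenius_monad C dag T \<mu> \<eta>"
    using frobenius_monad_if_kleisli_dagger by blast
qed

end
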